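(* Let $G=\bigcup_{n\in\mathbb N}G_n$ be a topological group which is an ascending union of topological groups $G_n$ with continuous inclusion homomorphisms. If two-sided product sets are large in $G$ (in particular, if product sets are large in $G$), then $G=\varinjlim G_n$ in the category of topological groups.
   Context: $\mathbb N=\{1,2,\dots\}$ and $-\mathbb N=\{-1,-2,\dots\}$. Topological groups are not assumed Hausdorff. $G=\bigcup_nG_n$ means: each $G_n$ is a topological group, $G_n\subseteq G_{n+1}$, $G$ is the union of the $G_n$, and all inclusion maps $G_n\to G_{n+1}$ and $G_n\to G$ are continuous homomorphisms (not necessarily embeddings). For a family $(H_i)_{i\in I}$ of topological groups, the weak direct product $\prod^*_{i\in I}H_i\le\prod_{i\in I}H_i$ is the subgroup of all $(h_i)_{i\in I}$ with $h_i=1$ for all but finitely many $i$. It is a topological group with the box topology, a basis of which is given by the sets $(\prod^*_{i\in I}H_i)\cap\prod_{i\in I}U_i$ with $U_i\subseteq H_i$ open and $1\in U_i$ for all but finitely many $i$. Product sets are large in $G$ if the product map $\pi\colon\prod^*_{n\in\mathbb N}G_n\to G$, $(g_n)_n\mapsto g_1g_2\cdots g_N$ (if $g_n=1$ for all $n>N$), takes identity neighbourhoods to identity neighbourhoods. Two-sided product sets are large in $G$ if the product map $\widetilde\pi\colon\prod^*_{n\in\mathbb N\cup(-\mathbb N)}G_{|n|}\to G$, $(g_n)_n\mapsto g_{-N}\cdots g_{-1}g_1g_2\cdots g_N$ (with $N$ so large that $g_n=1$ whenever $|n|>N$), takes identity neighbourhoods to identity neighbourhoods. $G=\varinjlim G_n$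 in the category of topological groups (and continuous homomorphisms) means: for each topological group $H$ and all continuous homomorphisms $\psi_n\colon G_n\to H$ with $\psi_{n+1}|_{G_n}=\psi_n$ there is a unique continuous homomorphism $\psi\colon G\to H$ with $\psi|_{G_n}=\psi_n$ for all $n$. *)

theory Defs
  imports "HOL-Analysis.Product_Topology"
    "HOL-Algebra.Product_Groups"
begin

locale topological_group = group G
  for G :: "('a, 'b) monoid_scheme" (structure) and T :: "'a topology" +
  assumes topspace_eq_carrier: "topspace T = carrier G"
    and mult_continuous: "continuous_map (prod_topology T T) T (\<lambda>(x, y). x \<otimes> y)"
    and inv_continuous: "continuous_map T T (\<lambda>x. inv x)"

definition continuous_hom ::
  "('a, 'b) monoid_scheme \<Rightarrow> 'a topology \<Rightarrow> ('c, 'd) monoid_scheme \<Rightarrow> 'c topology \<Rightarrow> ('a \<Rightarrow> 'c) set"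
  where "continuous_hom G S H T = {f \<in> hom G H. continuous_map S T f}"

text \<open>The indices of the sequence start at \<open>1\<close>; the values \<open>Gs 0\<close> and \<open>Ts 0\<close> are irrelevant.\<close>

locale ascending_union = topological_group G T
  for Gs :: "nat \<Rightarrow> ('a, 'b) monoid_scheme" and Ts :: "nat \<Rightarrow> 'a topology"
    and G :: "('a, 'c) monoid_scheme" (structure) and T :: "'a topology" +
  assumes topological_group_step: "n \<ge> 1 \<Longrightarrow> topological_group (Gs n) (Ts n)"
    and step_mono: "n \<ge> 1 \<Longrightarrow> carrier (Gs n) \<subseteq> carrier (Gs (Suc n))"
    and carrier_eq_Union: "carrier G = (\<Union>n\<in>{1..}. carrier (Gs n))"
    and step_inclusion:
      "n \<ge> 1 \<Longrightarrow> (\<lambda>x. x) \<in> continuous_hom (Gs n) (Ts n) (Gs (Suc n)) (Ts (Suc n))"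
    and inclusion: "n \<ge> 1 \<Longrightarrow> (\<lambda>x. x) \<in> continuous_hom (Gs n) (Ts n) G T"

text \<open>The weak direct product is the group \<^const>\<open>sum_group\<close>, whose elements are the functions in
  the (extensional) product that differ from the identity at only finitely many indices.\<close>

definition box_base ::
  "'i set \<Rightarrow> ('i \<Rightarrow> ('a, 'b) monoid_scheme) \<Rightarrow> ('i \<Rightarrow> 'a topology) \<Rightarrow> ('i \<Rightarrow> 'a) set \<Rightarrow> bool"
  where "box_base I H S B \<longleftrightarrow>
    (\<exists>U. (\<forall>i\<in>I. openin (S i) (U i)) \<and> finite {i \<in> I. \<one>\<^bsub>H i\<^esub> \<notin> U i} \<and>
         B = carrier (sum_group I H) \<inter> (\<Pi>\<^sub>E i\<in>I. U i))"

definition box_topology ::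
  "'i set \<Rightarrow> ('i \<Rightarrow> ('a, 'b) monoid_scheme) \<Rightarrow> ('i \<Rightarrow> 'a topology) \<Rightarrow> ('i \<Rightarrow> 'a) topology"
  where "box_topology I H S = topology (arbitrary union_of (box_base I H S))"

lemma openin_box_topology:
  "openin (box_topology I H S) = arbitrary union_of (box_base I H S)"
proof -
  have "box_base I H S (A \<inter> B)" if AB: "box_base I H S A" "box_base I H S B" for A B
  proof -
    from AB(1) obtain U where U: "\<forall>i\<in>I. openin (S i) (U i)"
        "finite {i \<in> I. \<one>\<^bsub>H i\<^esub> \<notin> U i}" "A = carrier (sum_group I H) \<inter> (\<Pi>\<^sub>E i\<in>I. U i)"
      unfolding box_base_def by (elim exE conjE)
    from AB(2) obtain V where V: "\<forall>i\<in>I. openin (S i) (V i)"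
        "finite {i \<in> I. \<one>\<^bsub>H i\<^esub> \<notin> V i}" "B = carrier (sum_group I H) \<inter> (\<Pi>\<^sub>E i\<in>I. V i)"
      unfolding box_base_def by (elim exE conjE)
    have "{i \<in> I. \<one>\<^bsub>H i\<^esub> \<notin> U i \<inter> V i} = {i \<in> I. \<one>\<^bsub>H i\<^esub> \<notin> U i} \<union> {i \<in> I. \<one>\<^bsub>H i\<^esub> \<notin> V i}"
      by auto
    then have "finite {i \<in> I. \<one>\<^bsub>H i\<^esub> \<notin> U i \<inter> V i}"
      using U(2) V(2) by simp
    moreover have "A \<inter> B = carrier (sum_group I H) \<inter> (\<Pi>\<^sub>E i\<in>I. U i \<inter> V i)"
      unfolding U(3) V(3) by (subst PiE_Int[symmetric]) blast
    moreover have "\<forall>i\<in>I. openin (S i) (U i \<inter> V i)"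
      using U(1) V(1) by (simp add: openin_Int)
    ultimately show ?thesis
      unfolding box_base_def by (intro exI[where x = "\<lambda>i. U i \<inter> V i"] conjI)
  qed
  then have "istopology (arbitrary union_of (box_base I H S))"
    by (rule istopology_base)
  then show ?thesis
    unfolding box_topology_def by (rule topology_inverse')
qed

definition nhds_in :: "'a topology \<Rightarrow> 'a \<Rightarrow> 'a set set"
  where "nhds_in T x = {V. V \<subseteq> topspace T \<and> x \<in> T interior_of V}"

definition list_product :: "('a, 'b) monoid_scheme \<Rightarrow> 'a list \<Rightarrow> 'a"
  where "list_product G xs = foldr (\<otimes>\<^bsub>G\<^esub>) xs \<one>\<^bsub>G\<^esub>"

text \<open>The product maps do not depend on the choice of the index from which on all entries are trivial;
  the least one is used.\<close>

definition product_map :: "('a, 'b) monoid_scheme \<Rightarrow> (nat \<Rightarrow> 'a) \<Rightarrow> 'a"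
  where "product_map G g =
    (let N = (LEAST N. \<forall>n>N. g n = \<one>\<^bsub>G\<^esub>) in list_product G (map g [1..<Suc N]))"

definition two_sided_product_map :: "('a, 'b) monoid_scheme \<Rightarrow> (int \<Rightarrow> 'a) \<Rightarrow> 'a"
  where "two_sided_product_map G g =
    (let N = (LEAST N. \<forall>n. \<bar>n\<bar> > int N \<longrightarrow> g n = \<one>\<^bsub>G\<^esub>)
     in list_product G (map g ([- int N .. -1] @ [1 .. int N])))"

definition product_sets_large ::
  "(nat \<Rightarrow> ('a, 'b) monoid_scheme) \<Rightarrow> (nat \<Rightarrow> 'a topology) \<Rightarrow> ('a, 'c) monoid_scheme \<Rightarrow> 'a topology \<Rightarrow> bool"
  where "product_sets_large Gs Ts G T \<longleftrightarrow>
    (\<forall>W \<in> nhds_in (box_topology {1..} Gs Ts) \<one>\<^bsub>sum_group {1..} Gs\<^esub>.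
       product_map G ` W \<in> nhds_in T \<one>\<^bsub>G\<^esub>)"

definition two_sided_product_sets_large ::
  "(nat \<Rightarrow> ('a, 'b) monoid_scheme) \<Rightarrow> (nat \<Rightarrow> 'a topology) \<Rightarrow> ('a, 'c) monoid_scheme \<Rightarrow> 'a topology \<Rightarrow> bool"
  where "two_sided_product_sets_large Gs Ts G T \<longleftrightarrow>
    (let I = - {0} :: int set; Gs' = (\<lambda>n. Gs (nat \<bar>n\<bar>)); Ts' = (\<lambda>n. Ts (nat \<bar>n\<bar>)) in
     \<forall>W \<in> nhds_in (box_topology I Gs' Ts') \<one>\<^bsub>sum_group I Gs'\<^esub>.
       two_sided_product_map G ` W \<in> nhds_in T \<one>\<^bsub>G\<^esub>)"

text \<open>A definition cannot quantify over types, so the type of the elements of the test groups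
  \<open>H\<close> is a parameter. A theorem with conclusion \<open>is_direct_limit TYPE('h) Gs Ts G T\<close>, where \<open>'h\<close> is
  a type variable that does not occur in the assumptions, covers all topological groups \<open>H\<close>.
  Functions are total, so uniqueness is expressed for functions that are extensional on
  the carrier of \<open>G\<close>.\<close>

definition is_direct_limit ::
  "'h itself \<Rightarrow> (nat \<Rightarrow> ('a, 'b) monoid_scheme) \<Rightarrow> (nat \<Rightarrow> 'a topology) \<Rightarrow>
   ('a, 'c) monoid_scheme \<Rightarrow> 'a topology \<Rightarrow> bool"
  where "is_direct_limit _ Gs Ts G T \<longleftrightarrow>
    (\<forall>(H :: 'h monoid) S \<psi>s.
       topological_group H S \<and>
       (\<forall>n\<ge>1. \<psi>s n \<in> continuous_hom (Gs n) (Ts n) H S) \<and>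
       (\<forall>n\<ge>1. \<forall>x\<in>carrier (Gs n). \<psi>s (Suc n) x = \<psi>s n x) \<longrightarrow>
       (\<exists>!\<psi>. \<psi> \<in> extensional (carrier G) \<and> \<psi> \<in> continuous_hom G T H S \<and>
             (\<forall>n\<ge>1. \<forall>x\<in>carrier (Gs n). \<psi> x = \<psi>s n x)))"

end

theory Submission
  imports Defs
begin

text \<open>A compatible family of continuous homomorphisms \<open>\<psi>\<^sub>n\<close> glues to a unique homomorphism \<open>\<psi>\<close> on the
  union, and the only question is whether \<open>\<psi>\<close> is continuous; by translation it suffices to treat the
  identity. Given an identity neighbourhood \<open>U\<close> in the target, choose identity neighbourhoods
  \<open>V\<^sub>0, V\<^sub>1, \<dots>\<close> with \<open>V\<^sub>0 V\<^sub>0 \<subseteq> U\<close> and \<open>V\<^bsub>n+1\<^esub> V\<^bsub>n+1\<^esub> \<subseteq> V\<^sub>n\<close>. Telescoping yields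
  \<open>V\<^sub>1 V\<^sub>2 \<cdots> V\<^sub>N \<subseteq> V\<^sub>0\<close> and \<open>V\<^sub>N \<cdots> V\<^sub>2 V\<^sub>1 \<subseteq> V\<^sub>0\<close> for all \<open>N\<close>
  (\<open>list_product_telescope\<close>). The preimages of the \<open>V\<^sub>n\<close> under the \<open>\<psi>\<^sub>n\<close> form a box whose
  two-sided product set is therefore mapped into \<open>V\<^sub>0 V\<^sub>0 \<subseteq> U\<close>; this set is an identity neighbourhood
  when two-sided product sets are large.

  One-sided product sets are contained in two-sided ones, because a one-sided family can be
  extended by the identity to negative indices. So largeness of the former implies largeness of
  the latter.\<close>

section \<open>Finite products\<close>

lemma list_product_Nil [simp]: "list_product G [] = \<one>\<^bsub>G\<^esub>"
  and list_product_Cons [simp]: "list_product G (x # xs) = x \<otimes>\<^bsub>G\<^esub> list_product G xs"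
  by (simp_all add: list_product_def)

context monoid
begin

lemma list_product_closed: "set xs \<subseteq> carrier G \<Longrightarrow> list_product G xs \<in> carrier G"
  by (induction xs) auto

lemma list_product_append:
  "set xs \<subseteq> carrier G \<Longrightarrow> set ys \<subseteq> carrier G \<Longrightarrow>
    list_product G (xs @ ys) = list_product G xs \<otimes> list_product G ys"
  by (induction xs) (auto simp: m_assoc list_product_closed)

lemma list_product_ones: "set xs \<subseteq> {\<one>} \<Longrightarrow> list_product G xs = \<one>"
  by (induction xs) auto

text \<open>Reading from the index \<open>Suc m\<close> outwards, the first factor and, inductively, the product of all
  later factors lie in \<open>V (Suc m)\<close>, so that one application of \<open>V (Suc m) V (Suc m) \<subseteq> V m\<close> suffices.
  The order of the two factors is immaterial, which gives the reversed product as well.\<close>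

lemma list_product_telescope:
  assumes "\<And>n. V n \<subseteq> carrier G" "\<And>n. \<one> \<in> V n"
    and "\<And>n x y. x \<in> V (Suc n) \<Longrightarrow> y \<in> V (Suc n) \<Longrightarrow> x \<otimes> y \<in> V n"
    and "\<And>n. n \<ge> 1 \<Longrightarrow> h n \<in> V n"
  shows "list_product G (map h [Suc m..<Suc m + k]) \<in> V m \<and>
    list_product G (map h (rev [Suc m..<Suc m + k])) \<in> V m"
proof (induction k arbitrary: m)
  case 0
  show ?case by (simp add: assms(2))
next
  case (Suc k)
  have split: "[Suc m..<Suc m + Suc k] = Suc m # [Suc (Suc m)..<Suc (Suc m) + k]"
    by (simp add: upt_conv_Cons)
  have car: "h n \<in> carrier G" if "n \<ge> 1" for n
    using assms(1,4) that by blast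
  have hm: "h (Suc m) \<in> V (Suc m)"
    by (rule assms(4)) simp
  have "list_product G (map h (rev [Suc m..<Suc m + Suc k])) =
      list_product G (map h (rev [Suc (Suc m)..<Suc (Suc m) + k])) \<otimes> h (Suc m)"
    unfolding split rev.simps map_append
    by (subst list_product_append) (auto simp: car)
  then show ?case
    unfolding split using Suc.IH[of "Suc m"] hm assms(3) by auto
qed

end

lemma hom_list_product:
  assumes "f \<in> hom G H" "f \<one>\<^bsub>G\<^esub> = \<one>\<^bsub>H\<^esub>" "monoid G" "set xs \<subseteq> carrier G"
  shows "f (list_product G xs) = list_product H (map f xs)"
  using assms(4)
  by (induction xs) (auto simp: assms(2) hom_mult[OF assms(1)] monoid.list_product_closed[OF assms(3)])

lemma int_upto_eq_map_nat:
  "[1..int N] = map int [1..<Suc N]"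
  "[- int N..-1] = map (\<lambda>n. - int n) (rev [1..<Suc N])"
proof -
  show "[1..int N] = map int [1..<Suc N]"
    by (induction N) (simp_all add: upto_rec2)
  show "[- int N..-1] = map (\<lambda>n. - int n) (rev [1..<Suc N])"
    by (induction N) (simp_all add: upto_rec1)
qed

section \<open>Identity neighbourhoods in topological groups\<close>

context topological_group
begin

lemma mult_nbhd:
  assumes "openin T U" "\<one> \<in> U"
  shows "\<exists>V. (openin T V \<and> \<one> \<in> V) \<and> (\<forall>x\<in>V. \<forall>y\<in>V. x \<otimes> y \<in> U)"
proof -
  let ?P = "{p \<in> topspace (prod_topology T T). (case p of (x, y) \<Rightarrow> x \<otimes> y) \<in> U}"
  have "openin (prod_topology T T) ?P"
    by (rule openin_continuous_map_preimage[OF mult_continuous assms(1)])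
  moreover have "(\<one>, \<one>) \<in> ?P"
    using assms(2) by (simp add: topspace_eq_carrier)
  ultimately obtain A B where "openin T A" "openin T B" "\<one> \<in> A" "\<one> \<in> B" "A \<times> B \<subseteq> ?P"
    unfolding openin_prod_topology_alt by meson
  then show ?thesis
    by (intro exI[of _ "A \<inter> B"]) (auto intro: openin_Int)
qed

lemma nbhd_sequence:
  assumes "openin T U" "\<one> \<in> U"
  obtains V where "\<And>n. openin T (V n)" "\<And>n. \<one> \<in> V n"
    "\<And>n x y. x \<in> V (Suc n) \<Longrightarrow> y \<in> V (Suc n) \<Longrightarrow> x \<otimes> y \<in> V n"
    "\<And>x y. x \<in> V 0 \<Longrightarrow> y \<in> V 0 \<Longrightarrow> x \<otimes> y \<in> U"
proof -
  obtain V0 where V0: "openin T V0 \<and> \<one> \<in> V0" "\<forall>x\<in>V0. \<forall>y\<in>V0. x \<otimes> y \<in> U"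
    using mult_nbhd[OF assms] by blast
  have "\<exists>V. \<forall>n. ((openin T (V n) \<and> \<one> \<in> V n) \<and> (n = 0 \<longrightarrow> V n = V0)) \<and>
      (\<forall>x\<in>V (Suc n). \<forall>y\<in>V (Suc n). x \<otimes> y \<in> V n)"
  proof (rule dependent_nat_choice)
    show "\<exists>A. (openin T A \<and> \<one> \<in> A) \<and> (0 = (0::nat) \<longrightarrow> A = V0)"
      using V0(1) by blast
    fix A and n :: nat
    assume "(openin T A \<and> \<one> \<in> A) \<and> (n = 0 \<longrightarrow> A = V0)"
    then show "\<exists>B. ((openin T B \<and> \<one> \<in> B) \<and> (Suc n = 0 \<longrightarrow> B = V0)) \<and>
        (\<forall>x\<in>B. \<forall>y\<in>B. x \<otimes> y \<in> A)"
      using mult_nbhd[of A] by auto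
  qed
  then obtain V where V: "\<And>n. openin T (V n)" "\<And>n. \<one> \<in> V n" "V 0 = V0"
      "\<And>n. \<forall>x\<in>V (Suc n). \<forall>y\<in>V (Suc n). x \<otimes> y \<in> V n"
    by blast
  show ?thesis
    by (rule that[of V]) (use V V0(2) in auto)
qed

lemma continuous_translation:
  assumes "a \<in> carrier G"
  shows "continuous_map T T (\<lambda>x. a \<otimes> x)"
proof -
  have "continuous_map T (prod_topology T T) (\<lambda>x. (a, x))"
    using assms by (simp add: continuous_map_pairwise o_def topspace_eq_carrier)
  from continuous_map_compose[OF this mult_continuous] show ?thesis
    by (simp add: o_def)
qed

end

text \<open>A point \<open>x\<close> with \<open>f x \<in> U\<close> is handled by pulling back the identity neighbourhood
  \<open>(f x)\<^sup>-\<^sup>1 U\<close> and translating the resulting set \<open>A\<close> to \<open>x A\<close>.\<close>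

lemma continuous_hom_if_continuous_at_one:
  assumes "topological_group G T" "topological_group H S" "f \<in> hom G H"
    and nbhd: "\<And>U. openin S U \<Longrightarrow> \<one>\<^bsub>H\<^esub> \<in> U \<Longrightarrow>
      \<exists>A. openin T A \<and> \<one>\<^bsub>G\<^esub> \<in> A \<and> f ` A \<subseteq> U"
  shows "continuous_map T S f"
proof -
  interpret G: topological_group G T by fact
  interpret H: topological_group H S by fact
  have f: "f x \<in> carrier H" if "x \<in> carrier G" for x
    using assms(3) that by (rule hom_in_carrier)
  show ?thesis
    unfolding continuous_map G.topspace_eq_carrier H.topspace_eq_carrier
  proof (intro conjI allI impI)
    show "f ` carrier G \<subseteq> carrier H"
      using f by blast
    fix U assume U: "openin S U"
    show "openin T {x \<in> carrier G. f x \<in> U}"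
    proof (subst openin_subopen, intro ballI)
      fix x assume "x \<in> {x \<in> carrier G. f x \<in> U}"
      then have x: "x \<in> carrier G" "f x \<in> U" by auto
      let ?U' = "{h \<in> topspace S. f x \<otimes>\<^bsub>H\<^esub> h \<in> U}"
      have "openin S ?U'"
        by (rule openin_continuous_map_preimage[OF H.continuous_translation[OF f[OF x(1)]] U])
      moreover have "\<one>\<^bsub>H\<^esub> \<in> ?U'"
        using x f by (simp add: H.topspace_eq_carrier)
      ultimately obtain A where A: "openin T A" "\<one>\<^bsub>G\<^esub> \<in> A" "f ` A \<subseteq> ?U'"
        using nbhd by blast
      let ?B = "{y \<in> topspace T. inv\<^bsub>G\<^esub> x \<otimes>\<^bsub>G\<^esub> y \<in> A}"
      have "openin T ?B"
        by (rule openin_continuous_map_preimage[OF G.continuous_translation A(1)]) (simp add: x)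
      moreover have "x \<in> ?B"
        using x A(2) by (simp add: G.topspace_eq_carrier)
      moreover have "?B \<subseteq> {x \<in> carrier G. f x \<in> U}"
      proof
        fix y assume y: "y \<in> ?B"
        then have yc: "y \<in> carrier G" by (simp add: G.topspace_eq_carrier)
        have "f y = f (x \<otimes>\<^bsub>G\<^esub> (inv\<^bsub>G\<^esub> x \<otimes>\<^bsub>G\<^esub> y))"
          using x yc by (simp flip: G.m_assoc)
        also have "\<dots> = f x \<otimes>\<^bsub>H\<^esub> f (inv\<^bsub>G\<^esub> x \<otimes>\<^bsub>G\<^esub> y)"
          using x yc by (intro hom_mult[OF assms(3)]) auto
        also have "\<dots> \<in> U"
          using y A(3) by auto
        finally show "y \<in> {x \<in> carrier G. f x \<in> U}"
          using yc by simp
      qed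
      ultimately show "\<exists>B. openin T B \<and> x \<in> B \<and> B \<subseteq> {x \<in> carrier G. f x \<in> U}"
        by blast
    qed
  qed
qed

section \<open>Identity neighbourhoods in the box topology\<close>

lemma openin_box:
  assumes "\<And>i. i \<in> I \<Longrightarrow> openin (S i) (U i)" "\<And>i. i \<in> I \<Longrightarrow> \<one>\<^bsub>H i\<^esub> \<in> U i"
  shows "openin (box_topology I H S) (carrier (sum_group I H) \<inter> (\<Pi>\<^sub>E i\<in>I. U i))"
proof -
  have "{i \<in> I. \<one>\<^bsub>H i\<^esub> \<notin> U i} = {}"
    using assms(2) by blast
  then have "finite {i \<in> I. \<one>\<^bsub>H i\<^esub> \<notin> U i}"
    by (simp only: finite.emptyI)
  then have "box_base I H S (carrier (sum_group I H) \<inter> (\<Pi>\<^sub>E i\<in>I. U i))"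
    unfolding box_base_def using assms(1) by blast
  then show ?thesis
    unfolding openin_box_topology by (rule union_of_inc[rotated]) (simp add: arbitrary_def)
qed

lemma box_in_nhds:
  assumes "\<And>i. i \<in> I \<Longrightarrow> group (H i)"
    and "\<And>i. i \<in> I \<Longrightarrow> openin (S i) (U i)" "\<And>i. i \<in> I \<Longrightarrow> \<one>\<^bsub>H i\<^esub> \<in> U i"
  shows "carrier (sum_group I H) \<inter> (\<Pi>\<^sub>E i\<in>I. U i)
    \<in> nhds_in (box_topology I H S) \<one>\<^bsub>sum_group I H\<^esub>"
proof -
  let ?B = "carrier (sum_group I H) \<inter> (\<Pi>\<^sub>E i\<in>I. U i)"
  have op: "openin (box_topology I H S) ?B"
    using assms(2,3) by (rule openin_box)
  have "\<one>\<^bsub>sum_group I H\<^esub> \<in> carrier (sum_group I H)"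
    using group.is_monoid[OF sum_group] assms(1) by (blast intro: monoid.one_closed)
  moreover have "\<one>\<^bsub>sum_group I H\<^esub> \<in> (\<Pi>\<^sub>E i\<in>I. U i)"
    using assms(3) by (simp add: one_sum_group)
  ultimately show ?thesis
    unfolding nhds_in_def using op by (simp add: interior_of_openin openin_subset)
qed

lemma nhds_box_contains_box:
  assumes "W \<in> nhds_in (box_topology I H S) \<one>\<^bsub>sum_group I H\<^esub>"
  obtains U where "\<And>i. i \<in> I \<Longrightarrow> openin (S i) (U i)" "\<And>i. i \<in> I \<Longrightarrow> \<one>\<^bsub>H i\<^esub> \<in> U i"
    "carrier (sum_group I H) \<inter> (\<Pi>\<^sub>E i\<in>I. U i) \<subseteq> W"
proof -
  obtain A where A: "openin (box_topology I H S) A" "\<one>\<^bsub>sum_group I H\<^esub> \<in> A" "A \<subseteq> W"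
    using assms unfolding nhds_in_def interior_of_def by blast
  then obtain B where B: "box_base I H S B" "\<one>\<^bsub>sum_group I H\<^esub> \<in> B" "B \<subseteq> A"
    unfolding openin_box_topology arbitrary_union_of_alt by blast
  then obtain U where U: "\<forall>i\<in>I. openin (S i) (U i)"
      "B = carrier (sum_group I H) \<inter> (\<Pi>\<^sub>E i\<in>I. U i)"
    unfolding box_base_def by blast
  have "\<one>\<^bsub>H i\<^esub> \<in> U i" if "i \<in> I" for i
    using B(2) that unfolding U(2) by (auto simp: one_sum_group)
  then show ?thesis
    using that[of U] U B(3) A(3) by blast
qed

section \<open>Ascending unions\<close>

context ascending_union
begin

lemma group_step: "n \<ge> 1 \<Longrightarrow> group (Gs n)"
  using topological_group_step topological_group.axioms(1) by blast

lemma carrier_mono: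
  assumes "1 \<le> m" "m \<le> n"
  shows "carrier (Gs m) \<subseteq> carrier (Gs n)"
  using assms(2)
proof (induction n rule: dec_induct)
  case (step n)
  then show ?case using step_mono[of n] assms(1) by auto
qed simp

lemma step_subset: "n \<ge> 1 \<Longrightarrow> carrier (Gs n) \<subseteq> carrier G"
  using carrier_eq_Union by auto

lemma step_mult: "n \<ge> 1 \<Longrightarrow> x \<in> carrier (Gs n) \<Longrightarrow> y \<in> carrier (Gs n) \<Longrightarrow> x \<otimes>\<^bsub>Gs n\<^esub> y = x \<otimes> y"
  using inclusion[of n] unfolding continuous_hom_def hom_def by auto

lemma step_one: "n \<ge> 1 \<Longrightarrow> \<one>\<^bsub>Gs n\<^esub> = \<one>"
  using hom_one[of "\<lambda>x. x" "Gs n" G] inclusion[of n] group_step[of n] is_group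
  unfolding continuous_hom_def by auto

lemma obtain_step:
  assumes "x \<in> carrier G" "y \<in> carrier G"
  obtains n where "n \<ge> 1" "x \<in> carrier (Gs n)" "y \<in> carrier (Gs n)"
proof -
  obtain k m where km: "k \<ge> 1" "m \<ge> 1" "x \<in> carrier (Gs k)" "y \<in> carrier (Gs m)"
    using assms carrier_eq_Union by auto
  show ?thesis
    by (rule that[of "max k m"])
      (use km carrier_mono[of k "max k m"] carrier_mono[of m "max k m"] in auto)
qed

lemma carrier_weak_product:
  assumes "\<And>i. i \<in> I \<Longrightarrow> k i \<ge> (1::nat)"
  shows "carrier (sum_group I (\<lambda>i. Gs (k i))) =
    {g \<in> \<Pi>\<^sub>E i\<in>I. carrier (Gs (k i)). finite {i \<in> I. g i \<noteq> \<one>}}"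
proof -
  have "{i \<in> I. g i \<noteq> \<one>\<^bsub>Gs (k i)\<^esub>} = {i \<in> I. g i \<noteq> \<one>}" for g
    using assms step_one by auto
  then show ?thesis
    using assms group_step by (subst carrier_sum_group) auto
qed

text \<open>Rewriting both halves over natural indices makes \<open>list_product_telescope\<close> applicable, which
  is uniform in the length; so the cut-off index need not be known.\<close>

lemma two_sided_product_map_nat:
  "\<exists>N. two_sided_product_map G g = list_product G
    (map (\<lambda>n. g (- int n)) (rev [1..<Suc N]) @ map (\<lambda>n. g (int n)) [1..<Suc N])"
  unfolding two_sided_product_map_def Let_def map_append int_upto_eq_map_nat map_map o_def
  by blast

lemma two_sided_product_map_closed:
  assumes "\<And>n. n \<noteq> 0 \<Longrightarrow> g n \<in> carrier G"
  shows "two_sided_product_map G g \<in> carrier G"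
proof -
  obtain N where N: "two_sided_product_map G g = list_product G
      (map (\<lambda>n. g (- int n)) (rev [1..<Suc N]) @ map (\<lambda>n. g (int n)) [1..<Suc N])"
    using two_sided_product_map_nat by blast
  show ?thesis
    unfolding N by (rule list_product_closed) (use assms in auto)
qed

lemma two_sided_product_map_extend:
  assumes g: "\<And>n. n \<ge> 1 \<Longrightarrow> g n \<in> carrier G"
    and e: "\<And>n. n > 0 \<Longrightarrow> e n = g (nat n)" "\<And>n. n < 0 \<Longrightarrow> e n = \<one>"
  shows "two_sided_product_map G e = product_map G g"
proof -
  \<comment> \<open>The cut-off indices used by the two product maps coincide.\<close>
  have "(\<forall>n. \<bar>n\<bar> > int N \<longrightarrow> e n = \<one>) \<longleftrightarrow> (\<forall>n>N. g n = \<one>)" for N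
  proof
    assume L: "\<forall>n. \<bar>n\<bar> > int N \<longrightarrow> e n = \<one>"
    show "\<forall>n>N. g n = \<one>"
    proof (intro allI impI)
      fix n assume "n > N"
      then show "g n = \<one>" using L[rule_format, of "int n"] e(1)[of "int n"] by simp
    qed
  next
    assume R: "\<forall>n>N. g n = \<one>"
    show "\<forall>n. \<bar>n\<bar> > int N \<longrightarrow> e n = \<one>"
    proof (intro allI impI)
      fix n :: int assume n: "\<bar>n\<bar> > int N"
      show "e n = \<one>"
      proof (cases "n < 0")
        case False
        with n have "n > 0" "nat n > N" by auto
        with R e(1) show ?thesis by simp
      qed (simp add: e(2))
    qed
  qed
  moreover have "list_product G (map e ([- int N..-1] @ [1..int N])) =
      list_product G (map g [1..<Suc N])" for N
  proof -
    have "map e [1..int N] = map g [1..<Suc N]"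
      unfolding int_upto_eq_map_nat map_map
      by (rule map_cong) (auto simp: e(1) simp del: upt_Suc)
    moreover have neg: "set (map e [- int N..-1]) \<subseteq> {\<one>}"
      using e(2) by auto
    moreover have "set (map g [1..<Suc N]) \<subseteq> carrier G"
      using g by auto
    moreover have "set (map e [- int N..-1]) \<subseteq> carrier G"
      using neg by auto
    ultimately show ?thesis
      by (simp only: map_append list_product_append list_product_ones list_product_closed l_one)
  qed
  ultimately show ?thesis
    unfolding two_sided_product_map_def product_map_def Let_def by simp
qed

text \<open>Extending a one-sided family by the identity to negative indices embeds a one-sided box
  into the two-sided box with the same sets at positive indices, and this embedding is compatible
  with the product maps.\<close>

lemma two_sided_product_sets_large_if_product_sets_large:
  assumes large: "product_sets_large Gs Ts G T"
  shows "two_sided_product_sets_large Gs Ts G T"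
  unfolding two_sided_product_sets_large_def Let_def
proof
  let ?I = "- {0} :: int set" and ?G = "\<lambda>n::int. Gs (nat \<bar>n\<bar>)" and ?T = "\<lambda>n::int. Ts (nat \<bar>n\<bar>)"
  fix W assume W: "W \<in> nhds_in (box_topology ?I ?G ?T) \<one>\<^bsub>sum_group ?I ?G\<^esub>"
  have I: "nat \<bar>i\<bar> \<ge> 1" if "i \<in> ?I" for i
    using that by auto
  have car2: "carrier (sum_group ?I ?G) =
      {g \<in> \<Pi>\<^sub>E i\<in>?I. carrier (?G i). finite {i \<in> ?I. g i \<noteq> \<one>}}"
    using I by (rule carrier_weak_product)
  have car1: "carrier (sum_group {1..} Gs) =
      {g \<in> \<Pi>\<^sub>E i\<in>{1..}. carrier (Gs i). finite {i \<in> {1..}. g i \<noteq> \<one>}}"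
    using carrier_weak_product[of "{1..}" "\<lambda>i. i"] by simp
  obtain U where U: "\<And>i. i \<in> ?I \<Longrightarrow> openin (?T i) (U i)" "\<And>i. i \<in> ?I \<Longrightarrow> \<one>\<^bsub>?G i\<^esub> \<in> U i"
      "carrier (sum_group ?I ?G) \<inter> (\<Pi>\<^sub>E i\<in>?I. U i) \<subseteq> W"
    using nhds_box_contains_box[OF W] by blast
  let ?B = "carrier (sum_group {1..} Gs) \<inter> (\<Pi>\<^sub>E i\<in>{1..}. U (int i))"
  have "?B \<in> nhds_in (box_topology {1..} Gs Ts) \<one>\<^bsub>sum_group {1..} Gs\<^esub>"
  proof (rule box_in_nhds)
    fix i :: nat assume "i \<in> {1..}"
    then show "group (Gs i)" "openin (Ts i) (U (int i))" "\<one>\<^bsub>Gs i\<^esub> \<in> U (int i)"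
      using U(1,2)[of "int i"] group_step[of i] by auto
  qed
  then have nb: "product_map G ` ?B \<in> nhds_in T \<one>"
    using large unfolding product_sets_large_def by blast
  have "product_map G ` ?B \<subseteq> two_sided_product_map G ` W"
  proof
    fix p assume "p \<in> product_map G ` ?B"
    then obtain g where g: "g \<in> ?B" "p = product_map G g"
      by blast
    define e where "e = (\<lambda>n::int. if n > 0 then g (nat n) else if n < 0 then \<one> else undefined)"
    have gc: "g n \<in> carrier (Gs n)" "g n \<in> U (int n)" if "n \<ge> 1" for n
      using g(1) that unfolding car1 by (auto dest: PiE_mem)
    have "{i \<in> ?I. e i \<noteq> \<one>} \<subseteq> int ` {i \<in> {1..}. g i \<noteq> \<one>}"
    proof
      fix i assume "i \<in> {i \<in> ?I. e i \<noteq> \<one>}"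
      then have "i = int (nat i)" "nat i \<in> {i \<in> {1..}. g i \<noteq> \<one>}"
        by (auto simp: e_def split: if_splits)
      then show "i \<in> int ` {i \<in> {1..}. g i \<noteq> \<one>}"
        by (rule image_eqI)
    qed
    moreover have "finite {i \<in> {1..}. g i \<noteq> \<one>}"
      using g(1) unfolding car1 by blast
    ultimately have fin: "finite {i \<in> ?I. e i \<noteq> \<one>}"
      using finite_subset by blast
    have mem: "e i \<in> carrier (?G i) \<and> e i \<in> U i" if "i \<in> ?I" for i
    proof (cases "i > 0")
      case True
      then show ?thesis using gc[of "nat i"] by (simp add: e_def)
    next
      case False
      then have "e i = \<one>\<^bsub>?G i\<^esub>"
        using that I step_one by (auto simp: e_def)
      moreover have "\<one>\<^bsub>?G i\<^esub> \<in> carrier (?G i)"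
        using group_step[OF I[OF that]] by (simp add: group.is_monoid monoid.one_closed)
      ultimately show ?thesis using U(2)[OF that] by simp
    qed
    have ext: "e i = undefined" if "i \<notin> ?I" for i
      using that by (simp add: e_def)
    have "e \<in> carrier (sum_group ?I ?G) \<inter> (\<Pi>\<^sub>E i\<in>?I. U i)"
      unfolding car2 using fin mem ext by (auto intro!: PiE_I)
    then have "e \<in> W" using U(3) by blast
    moreover have "two_sided_product_map G e = p"
      unfolding g(2)
    proof (rule two_sided_product_map_extend)
      fix n :: nat assume "n \<ge> 1"
      then show "g n \<in> carrier G"
        using gc(1) step_subset by blast
    qed (auto simp: e_def)
    ultimately show "p \<in> two_sided_product_map G ` W" by blast
  qed
  moreover have "two_sided_product_map G ` W \<subseteq> topspace T"
  proof
    fix p assume "p \<in> two_sided_product_map G ` W"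
    then obtain g where g: "g \<in> W" "p = two_sided_product_map G g" by blast
    have "W \<subseteq> topspace (box_topology ?I ?G ?T)"
      using W unfolding nhds_in_def by blast
    then have "g \<in> carrier (sum_group ?I ?G)"
      using g(1) unfolding topspace_def openin_box_topology arbitrary_union_of_alt box_base_def
      by blast
    then have "g n \<in> carrier G" if "n \<noteq> 0" for n
      using that step_subset[OF I[of n]] unfolding car2 by (auto dest: PiE_mem)
    then show "p \<in> topspace T"
      unfolding g(2) topspace_eq_carrier by (rule two_sided_product_map_closed)
  qed
  ultimately show "two_sided_product_map G ` W \<in> nhds_in T \<one>"
    using nb interior_of_mono[of "product_map G ` ?B" "two_sided_product_map G ` W" T]
    unfolding nhds_in_def mem_Collect_eq by (meson subsetD)
qed

text \<open>Any two elements lie in a common step, so the homomorphism property can be checked there.\<close>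

lemma glue_homs:
  assumes H: "group H" and hom: "\<And>n. n \<ge> 1 \<Longrightarrow> \<psi>s n \<in> hom (Gs n) H"
    and compat: "\<And>n x. n \<ge> 1 \<Longrightarrow> x \<in> carrier (Gs n) \<Longrightarrow> \<psi>s (Suc n) x = \<psi>s n x"
  obtains \<psi> where "\<psi> \<in> extensional (carrier G)" "\<psi> \<in> hom G H"
    "\<And>n x. n \<ge> 1 \<Longrightarrow> x \<in> carrier (Gs n) \<Longrightarrow> \<psi> x = \<psi>s n x"
proof -
  have up: "\<psi>s n x = \<psi>s m x" if "m \<le> n" "1 \<le> m" "x \<in> carrier (Gs m)" for m n x
    using that(1)
  proof (induction n rule: dec_induct)
    case (step n)
    then show ?case
      using compat[of n x] carrier_mono[of m n] that by auto
  qed simp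
  define k where "k x = (SOME n. n \<ge> 1 \<and> x \<in> carrier (Gs n))" for x
  define \<psi> where "\<psi> = restrict (\<lambda>x. \<psi>s (k x) x) (carrier G)"
  have eq: "\<psi> x = \<psi>s n x" if n: "n \<ge> 1" "x \<in> carrier (Gs n)" for n x
  proof -
    have k: "k x \<ge> 1 \<and> x \<in> carrier (Gs (k x))"
      unfolding k_def by (rule someI[of _ n]) (use n in simp)
    have "x \<in> carrier G"
      using n step_subset by blast
    then have "\<psi> x = \<psi>s (k x) x"
      by (simp add: \<psi>_def)
    also have "\<dots> = \<psi>s n x"
      using up[of "k x" n x] up[of n "k x" x] k n by (cases "k x \<le> n") auto
    finally show ?thesis .
  qed
  have "\<psi> \<in> hom G H"
  proof (rule homI)
    fix x assume "x \<in> carrier G"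
    then obtain n where "n \<ge> 1" "x \<in> carrier (Gs n)"
      using obtain_step by blast
    then show "\<psi> x \<in> carrier H"
      using eq hom_in_carrier[OF hom] by simp
  next
    fix x y assume "x \<in> carrier G" "y \<in> carrier G"
    then obtain n where n: "n \<ge> 1" "x \<in> carrier (Gs n)" "y \<in> carrier (Gs n)"
      using obtain_step by blast
    interpret Gn: group "Gs n" using n(1) by (rule group_step)
    have "\<psi> (x \<otimes>\<^bsub>Gs n\<^esub> y) = \<psi> x \<otimes>\<^bsub>H\<^esub> \<psi> y"
      using n by (simp add: eq hom_mult[OF hom])
    then show "\<psi> (x \<otimes> y) = \<psi> x \<otimes>\<^bsub>H\<^esub> \<psi> y"
      using n by (simp add: step_mult)
  qed
  then show ?thesis
    using that[of \<psi>] eq by (simp add: \<psi>_def)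
qed

text \<open>The box of the preimages of a sequence \<open>V\<close> with \<open>V (Suc n) V (Suc n) \<subseteq> V n\<close> has a
  two-sided product set that \<open>\<psi>\<close> maps into \<open>V 0 V 0\<close>. By largeness, this controls \<open>\<psi>\<close> near the
  identity.\<close>

lemma continuous_if_continuous_on_steps:
  assumes large: "two_sided_product_sets_large Gs Ts G T"
    and H: "topological_group H S" and hom: "\<psi> \<in> hom G H"
    and cont: "\<And>n. n \<ge> 1 \<Longrightarrow> continuous_map (Ts n) S \<psi>"
  shows "continuous_map T S \<psi>"
proof (rule continuous_hom_if_continuous_at_one[OF topological_group_axioms H hom])
  interpret H: topological_group H S by (rule H)
  let ?I = "- {0} :: int set" and ?G = "\<lambda>n::int. Gs (nat \<bar>n\<bar>)" and ?T = "\<lambda>n::int. Ts (nat \<bar>n\<bar>)"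
  fix U assume U: "openin S U" "\<one>\<^bsub>H\<^esub> \<in> U"
  obtain V where V: "\<And>n. openin S (V n)" "\<And>n. \<one>\<^bsub>H\<^esub> \<in> V n"
      "\<And>n x y. x \<in> V (Suc n) \<Longrightarrow> y \<in> V (Suc n) \<Longrightarrow> x \<otimes>\<^bsub>H\<^esub> y \<in> V n"
      "\<And>x y. x \<in> V 0 \<Longrightarrow> y \<in> V 0 \<Longrightarrow> x \<otimes>\<^bsub>H\<^esub> y \<in> U"
    using H.nbhd_sequence[OF U] by blast
  have Vc: "V n \<subseteq> carrier H" for n
    using openin_subset[OF V(1)] by (simp add: H.topspace_eq_carrier)
  have one: "\<psi> \<one> = \<one>\<^bsub>H\<^esub>"
    using hom_one[OF hom] is_group H.is_group by simp
  define P where "P n = {x \<in> topspace (Ts n). \<psi> x \<in> V n}" for n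
  have top: "topspace (Ts n) = carrier (Gs n)" if "n \<ge> 1" for n
    using topological_group_step[OF that] by (rule topological_group.topspace_eq_carrier)
  let ?B = "carrier (sum_group ?I ?G) \<inter> (\<Pi>\<^sub>E i\<in>?I. P (nat \<bar>i\<bar>))"
  have "?B \<in> nhds_in (box_topology ?I ?G ?T) \<one>\<^bsub>sum_group ?I ?G\<^esub>"
  proof (rule box_in_nhds)
    fix i assume "i \<in> ?I"
    then have i: "nat \<bar>i\<bar> \<ge> 1" by auto
    show "group (?G i)" using i by (rule group_step)
    show "openin (?T i) (P (nat \<bar>i\<bar>))"
      unfolding P_def using cont[OF i] V(1) by (rule openin_continuous_map_preimage)
    show "\<one>\<^bsub>?G i\<^esub> \<in> P (nat \<bar>i\<bar>)"
      using group.is_monoid[OF group_step[OF i]] monoid.one_closed[of "?G i"]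
      by (simp add: P_def top[OF i] step_one[OF i] one V(2))
  qed
  then have nb: "two_sided_product_map G ` ?B \<in> nhds_in T \<one>"
    using large unfolding two_sided_product_sets_large_def Let_def by blast
  have sub: "\<psi> (two_sided_product_map G g) \<in> U" if g: "g \<in> ?B" for g
  proof -
    have gP: "g i \<in> P (nat \<bar>i\<bar>)" if "i \<noteq> 0" for i
      using g that by (auto dest: PiE_mem)
    have gc: "g i \<in> carrier G" if "i \<noteq> 0" for i
    proof -
      have "nat \<bar>i\<bar> \<ge> 1" using that by auto
      then show ?thesis
        using gP[OF that] top step_subset unfolding P_def by blast
    qed
    have gV: "\<psi> (g (int n)) \<in> V n" "\<psi> (g (- int n)) \<in> V n" if "n \<ge> 1" for n
      using gP[of "int n"] gP[of "- int n"] that by (auto simp: P_def)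
    obtain N where N: "two_sided_product_map G g = list_product G
        (map (\<lambda>n. g (- int n)) (rev [1..<Suc N]) @ map (\<lambda>n. g (int n)) [1..<Suc N])"
      using two_sided_product_map_nat by blast
    let ?l = "map (\<lambda>n. g (- int n)) (rev [1..<Suc N])" and ?r = "map (\<lambda>n. g (int n)) [1..<Suc N]"
    have c: "set ?l \<subseteq> carrier G" "set ?r \<subseteq> carrier G"
      using gc by auto
    have r: "\<psi> (list_product G ?r) \<in> V 0"
      unfolding hom_list_product[OF hom one is_monoid c(2)] map_map o_def
      using H.list_product_telescope[of V "\<lambda>n. \<psi> (g (int n))" 0 N, OF Vc V(2,3) gV(1)]
      by (simp del: upt_Suc)
    have l: "\<psi> (list_product G ?l) \<in> V 0"
      unfolding hom_list_product[OF hom one is_monoid c(1)] map_map o_def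
      using H.list_product_telescope[of V "\<lambda>n. \<psi> (g (- int n))" 0 N, OF Vc V(2,3) gV(2)]
      by (simp del: upt_Suc)
    have "\<psi> (two_sided_product_map G g) = \<psi> (list_product G ?l) \<otimes>\<^bsub>H\<^esub> \<psi> (list_product G ?r)"
      unfolding N list_product_append[OF c]
      using c by (intro hom_mult[OF hom] list_product_closed)
    then show ?thesis
      using V(4)[OF l r] by simp
  qed
  obtain A where "openin T A" "\<one> \<in> A" "A \<subseteq> two_sided_product_map G ` ?B"
    using nb unfolding nhds_in_def interior_of_def by blast
  then show "\<exists>A. openin T A \<and> \<one> \<in> A \<and> \<psi> ` A \<subseteq> U"
    using sub by blast
qed

lemma is_direct_limit_if_two_sided_product_sets_large:
  assumes large: "two_sided_product_sets_large Gs Ts G T"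
  shows "is_direct_limit TYPE('h) Gs Ts G T"
  unfolding is_direct_limit_def
proof (intro allI impI, elim conjE)
  fix H :: "'h monoid" and S \<psi>s
  assume H: "topological_group H S"
    and \<psi>s: "\<forall>n\<ge>1. \<psi>s n \<in> continuous_hom (Gs n) (Ts n) H S"
    and compat: "\<forall>n\<ge>1. \<forall>x\<in>carrier (Gs n). \<psi>s (Suc n) x = \<psi>s n x"
  obtain \<psi> where \<psi>: "\<psi> \<in> extensional (carrier G)" "\<psi> \<in> hom G H"
      "\<And>n x. n \<ge> 1 \<Longrightarrow> x \<in> carrier (Gs n) \<Longrightarrow> \<psi> x = \<psi>s n x"
  proof (rule glue_homs[of H \<psi>s])
    show "group H" using H by (rule topological_group.axioms(1))
  qed (use \<psi>s compat in \<open>auto simp: continuous_hom_def\<close>)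
  have "continuous_map (Ts n) S \<psi>" if n: "n \<ge> 1" for n
  proof (rule continuous_map_eq)
    show "continuous_map (Ts n) S (\<psi>s n)"
      using \<psi>s n by (auto simp: continuous_hom_def)
    show "\<psi>s n x = \<psi> x" if "x \<in> topspace (Ts n)" for x
      using \<psi>(3)[OF n] that topological_group.topspace_eq_carrier[OF topological_group_step[OF n]]
      by simp
  qed
  then have "continuous_map T S \<psi>"
    by (rule continuous_if_continuous_on_steps[OF large H \<psi>(2)])
  then have "\<psi> \<in> continuous_hom G T H S"
    using \<psi>(2) by (simp add: continuous_hom_def)
  moreover have "\<phi> = \<psi>" if "\<phi> \<in> extensional (carrier G)"
      "\<forall>n\<ge>1. \<forall>x\<in>carrier (Gs n). \<phi> x = \<psi>s n x" for \<phi>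
  proof (rule extensionalityI[OF that(1) \<psi>(1)])
    fix x assume "x \<in> carrier G"
    then obtain n where "n \<ge> 1" "x \<in> carrier (Gs n)"
      using obtain_step by blast
    then show "\<phi> x = \<psi> x" using that(2) \<psi>(3) by simp
  qed
  moreover have "\<forall>n\<ge>1. \<forall>x\<in>carrier (Gs n). \<psi> x = \<psi>s n x"
    using \<psi>(3) by blast
  ultimately show "\<exists>!\<psi>. \<psi> \<in> extensional (carrier G) \<and> \<psi> \<in> continuous_hom G T H S \<and>
      (\<forall>n\<ge>1. \<forall>x\<in>carrier (Gs n). \<psi> x = \<psi>s n x)"
    using \<psi>(1) by (intro ex1I[of _ \<psi>] conjI) blast+
qed

end

theorem proposition11p8:
  fixes Gs :: "nat \<Rightarrow> ('a, 'b) monoid_scheme" and Ts :: "nat \<Rightarrow> 'a topology"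
    and G :: "('a, 'c) monoid_scheme" and T :: "'a topology"
  assumes "ascending_union Gs Ts G T"
  shows "(two_sided_product_sets_large Gs Ts G T \<longrightarrow> is_direct_limit TYPE('h) Gs Ts G T) \<and>
    (product_sets_large Gs Ts G T \<longrightarrow> two_sided_product_sets_large Gs Ts G T) \<and>
    (product_sets_large Gs Ts G T \<longrightarrow> is_direct_limit TYPE('h) Gs Ts G T)"
proof -
  interpret ascending_union Gs Ts G T by (rule assms)
  show ?thesis
    using is_direct_limit_if_two_sided_product_sets_large
      two_sided_product_sets_large_if_product_sets_large by blast
qed

end
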